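(* Let $\pi^{cc}=(\bar\tau,\bar f,\dots,\bar f)\in\Pi^{cc}$, $\pi=(\bar\tau,f_0,f_1,\dots,f_{\bar\tau})\in\Pi$, and $\pi'=(\bar\tau,f'_0,f'_1,\dots,f'_{\bar\tau})\in\Pi$ be shipment policies with the same cutoff point $\bar\tau$, and suppose all three have the same average express shipment fee: $$\bar f=\frac{1}{\bar\tau+1}\sum_{j=0}^{\bar\tau}f_j=\frac{1}{\bar\tau+1}\sum_{j=0}^{\bar\tau}f'_j.$$ Moreover, suppose that for each $\tau\in\{1,\dots,\bar\tau\}$, $$\frac1\tau\sum_{j=0}^{\tau-1}f_j\ \le\ \frac1\tau\sum_{j=0}^{\tau-1}f'_j\ \le\ \bar f.$$ Then $\mathbb{E}[B^{\pi}]\le\mathbb{E}[B^{\pi'}]\le\mathbb{E}[B^{\pi^{cc}}]$.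
   Context: Model. Fix $T\in\mathbb{N}$, $T\ge 1$, $\lambda>0$, reals $0\le U_{\min}<U_{\max}<\infty$, and a discrete random variable $K$ with support $\mathbb{N}_0$ such that $\rho=\lambda/\mathbb{E}[K]<1$. Put $w(f)=\frac{U_{\max}-f}{U_{\max}-U_{\min}}$ for $f\in[U_{\min},U_{\max}]$. Policies. A shipment policy is $\pi=(\bar\tau,f_0,\dots,f_{\bar\tau})$ with cutoff point $\bar\tau\in\{0,\dots,T-1\}$ and fees $f_\tau\in[U_{\min},U_{\max}]$ for $\tau=0,\dots,\bar\tau$; $\Pi$ is the set of all of them. $\Pi^{cc}$ is the set of constant cutoff point policies $(\bar\tau,f,\dots,f)$ with $\bar\tau\in\{0,\dots,T-1\}$, $f\in[U_{\min},U_{\max}]$. Dynamics under $\pi$. Time is $t\in\mathbb{N}_0$; the age is $\tau=t \bmod T$; cycle $l$ is $\{lT,\dots,lT+T-1\}$. For each $t$ with age $\tau$: if $\tau\le\bar\tau$, $E_t\sim\mathrm{Poi}(w(f_\tau)\lambda)$ and $N_t\sim\mathrm{Poi}((1-w(f_\tau))\lambda)$; if $\tau>\bar\tau$, $E_t=0$ and $N_t\sim\mathrm{Poi}(\lambda)$. Let $D_t=E_t+N_t$, and $K_t\sim K$. All $E_t,N_t,K_t$, $t\in\mathbb{N}_0$, are independent. The backlogs evolve by $X^\Sigma_{t+1}=(X^\Sigma_t+D_t-K_t)^+$, and $X^h_{t+1}=(X^h_t+E_t-K_t)^+$ if $t\bmod T\ne T-1$, $X^h_{t+1}=(X^\Sigma_t+D_t-K_t)^+$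 if $t\bmod T=T-1$, where $x^+=\max(x,0)$, from a fixed deterministic initial state with $X^h_0\le X^\Sigma_0$. Backorders. The backorders of cycle $l$ are $B_l=(X^h_{lT+T-1}+E_{lT+T-1}-K_{lT+T-1})^+$, and $\mathbb{E}[B^\pi]=\lim_{L\to\infty}\frac1L\sum_{l=0}^{L-1}\mathbb{E}[B_l]$ (long-run average; it does not depend on the initial state). *)

theory Defs
  imports "HOL-Probability.Probability"
begin

text \<open>
  A policy is a pair of a cutoff point \<open>c\<close> and a fee schedule; only the fees at
  ages \<open>0, \<dots>, c\<close> are constrained, and only these enter the dynamics.
\<close>

type_synonym policy = "nat \<times> (nat \<Rightarrow> real)"

definition policies :: "nat \<Rightarrow> real \<Rightarrow> real \<Rightarrow> policy set" where
  "policies T U_min U_max =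
     {(c, f). c < T \<and> (\<forall>\<tau>\<le>c. f \<tau> \<in> {U_min..U_max})}"

definition const_policies :: "nat \<Rightarrow> real \<Rightarrow> real \<Rightarrow> policy set" where
  "const_policies T U_min U_max =
     {(c, \<lambda>_. f) | c f. c < T \<and> f \<in> {U_min..U_max}}"

definition express_share :: "real \<Rightarrow> real \<Rightarrow> real \<Rightarrow> real" where
  "express_share U_min U_max f = (U_max - f) / (U_max - U_min)"

text \<open>
  The library's \<^const>\<open>poisson_pmf\<close> is specified for positive rates only. Rate 0
  (fee \<open>U_max\<close>, or \<open>U_min\<close> for the normal orders) is the point mass at 0.
\<close>

definition poisson0_pmf :: "real \<Rightarrow> nat pmf" where
  "poisson0_pmf r = (if r = 0 then return_pmf 0 else poisson_pmf r)"

definition express_law :: "real \<Rightarrow> real \<Rightarrow> real \<Rightarrow> policy \<Rightarrow> nat \<Rightarrow> nat pmf" where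
  "express_law U_min U_max lam \<pi> \<tau> =
     (if \<tau> \<le> fst \<pi> then poisson0_pmf (express_share U_min U_max (snd \<pi> \<tau>) * lam)
      else return_pmf 0)"

definition normal_law :: "real \<Rightarrow> real \<Rightarrow> real \<Rightarrow> policy \<Rightarrow> nat \<Rightarrow> nat pmf" where
  "normal_law U_min U_max lam \<pi> \<tau> =
     (if \<tau> \<le> fst \<pi> then poisson0_pmf ((1 - express_share U_min U_max (snd \<pi> \<tau>)) * lam)
      else poisson0_pmf lam)"

text \<open>
  The sample space is the canonical one: an outcome \<open>\<omega>\<close> assigns to every period \<open>t\<close>
  the triple \<open>(E\<^sub>t, N\<^sub>t, K\<^sub>t)\<close>, and the product measure makes all these coordinates
  independent. All expectations below depend only on this joint law.
\<close>

type_synonym outcome = "nat \<Rightarrow> nat \<times> nat \<times> nat"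

definition outcome_measure ::
  "nat \<Rightarrow> real \<Rightarrow> real \<Rightarrow> real \<Rightarrow> nat pmf \<Rightarrow> policy \<Rightarrow> outcome measure" where
  "outcome_measure T U_min U_max lam K \<pi> =
     (\<Pi>\<^sub>M t\<in>UNIV. measure_pmf
        (pair_pmf (express_law U_min U_max lam \<pi> (t mod T))
          (pair_pmf (normal_law U_min U_max lam \<pi> (t mod T)) K)))"

definition express_orders :: "outcome \<Rightarrow> nat \<Rightarrow> nat" where
  "express_orders \<omega> t = fst (\<omega> t)"

definition normal_orders :: "outcome \<Rightarrow> nat \<Rightarrow> nat" where
  "normal_orders \<omega> t = fst (snd (\<omega> t))"

definition capacity :: "outcome \<Rightarrow> nat \<Rightarrow> nat" where
  "capacity \<omega> t = snd (snd (\<omega> t))"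

text \<open>
  Backlogs are natural numbers, so truncated subtraction is the positive part \<open>(\<cdot>)\<^sup>+\<close>.
\<close>

primrec total_backlog :: "nat \<Rightarrow> outcome \<Rightarrow> nat \<Rightarrow> nat" where
  "total_backlog x\<Sigma> \<omega> 0 = x\<Sigma>"
| "total_backlog x\<Sigma> \<omega> (Suc t) =
     (total_backlog x\<Sigma> \<omega> t + (express_orders \<omega> t + normal_orders \<omega> t)) - capacity \<omega> t"

primrec express_backlog :: "nat \<Rightarrow> nat \<Rightarrow> nat \<Rightarrow> outcome \<Rightarrow> nat \<Rightarrow> nat" where
  "express_backlog T xh x\<Sigma> \<omega> 0 = xh"
| "express_backlog T xh x\<Sigma> \<omega> (Suc t) =
     (if t mod T \<noteq> T - 1
      then (express_backlog T xh x\<Sigma> \<omega> t + express_orders \<omega> t) - capacity \<omega> t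
      else (total_backlog x\<Sigma> \<omega> t + (express_orders \<omega> t + normal_orders \<omega> t)) - capacity \<omega> t)"

definition cycle_backorders :: "nat \<Rightarrow> nat \<Rightarrow> nat \<Rightarrow> outcome \<Rightarrow> nat \<Rightarrow> nat" where
  "cycle_backorders T xh x\<Sigma> \<omega> l =
     (let t = l * T + T - 1
      in (express_backlog T xh x\<Sigma> \<omega> t + express_orders \<omega> t) - capacity \<omega> t)"

definition mean_backorders ::
  "nat \<Rightarrow> real \<Rightarrow> real \<Rightarrow> real \<Rightarrow> nat pmf \<Rightarrow> nat \<Rightarrow> nat \<Rightarrow> policy \<Rightarrow> real" where
  "mean_backorders T U_min U_max lam K xh x\<Sigma> \<pi> =
     lim (\<lambda>L. 1 / real L *
       (\<Sum>l<L. \<integral>\<omega>. real (cycle_backorders T xh x\<Sigma> \<omega> l) \<partial>outcome_measure T U_min U_max lam K \<pi>))"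

text \<open>
  The traffic intensity, with values in the extended nonnegative reals because \<open>K\<close> may have
  infinite mean; the intensity is then 0.
\<close>

definition traffic_intensity :: "real \<Rightarrow> nat pmf \<Rightarrow> ennreal" where
  "traffic_intensity lam K = ennreal lam / (\<integral>\<^sup>+k. of_nat k \<partial>measure_pmf K)"

end

theory Submission
  imports Defs
begin

text \<open>
  Total demand is Poisson with rate \<open>lam\<close> in every period, whatever the fees are. A policy only
  decides at which ages of the cycle the express orders arrive: a low fee means a high express rate,
  so low partial sums of fees mean high partial sums of express rates. With equal total rates, this
  is the same as saying that express orders arrive earlier, and orders that arrive earlier have more
  chances to be served before the end of the cycle.

  \<^item> Postponing orders. By the convolution property of the Poisson distribution, rate \<open>d\<close> can be moved
  from one period to the next by moving an independent Poisson number of orders. Since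
  \<open>(y + u)\<^sup>+ \<le> y\<^sup>+ + u\<close>, this can only increase the backlog on every path
  (\<open>period_mean_postpone\<close>). If the partial sums of one rate sequence dominate those of another with
  the same total, finitely many such moves lead from the first to the second
  (\<open>poisson_mean_le_if_earlier\<close>).

  \<^item> Reduction to one chain. From cycle 1 on, the express backlog at the start of a cycle equals the
  total backlog. Hence the backorders of cycle \<open>l\<close> are the state of a single reflected walk which is
  fed by all orders until time \<open>l * T\<close> and by express orders afterwards, and their mean is the
  \<open>(l * T)\<close>-th iterate of one policy-independent operator, applied to the value of a cycle under the
  policy (\<open>nn_integral_cycle_backorders\<close>). The comparison of the values of a cycle therefore gives the
  comparison of the mean backorders in each cycle except the first.

  \<^item> Existence of the long-run average. The average is a limit, which must exist before inequalities
  can be passed to it. Stability yields a weight \<open>z > 1\<close> with \<open>E[z^(D - K)] < 1\<close>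
  (\<open>exists_contraction_weight\<close>). One period then contracts the Lipschitz constant with respect to
  the metric \<open>\<bar>z^x - z^y\<bar>\<close>, so the expected values along the chain form a Cauchy sequence with
  geometrically decreasing increments (\<open>convergent_iterated_period_mean\<close>). Their Cesaro means
  have the same limit.
\<close>

section \<open>One period of the backlog recursion\<close>

text \<open>
  Values lie in the extended nonnegative reals, so that all iterated expectations make sense without
  integrability conditions.
\<close>

definition period_mean :: "nat pmf \<Rightarrow> nat pmf \<Rightarrow> (nat \<Rightarrow> ennreal) \<Rightarrow> nat \<Rightarrow> ennreal" where
  "period_mean K q h x = (\<integral>\<^sup>+e. \<integral>\<^sup>+k. h (x + e - k) \<partial>measure_pmf K \<partial>measure_pmf q)"

lemma period_mean_le:
  assumes "\<And>y. h y \<le> h' y"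
  shows "period_mean K q h x \<le> period_mean K q h' x"
  unfolding period_mean_def by (intro nn_integral_mono assms)

lemma mono_period_mean:
  assumes "mono h"
  shows "mono (period_mean K q h)"
  unfolding period_mean_def
  by (intro monoI nn_integral_mono monoD[OF assms] diff_le_mono add_right_mono)

lemma nn_integral_pmf_commute:
  "(\<integral>\<^sup>+x. \<integral>\<^sup>+y. f x y \<partial>measure_pmf q \<partial>measure_pmf p) =
   (\<integral>\<^sup>+y. \<integral>\<^sup>+x. f x y \<partial>measure_pmf p \<partial>measure_pmf q)"
proof -
  have "(\<integral>\<^sup>+x. \<integral>\<^sup>+y. f x y \<partial>measure_pmf q \<partial>measure_pmf p) =
        (\<integral>\<^sup>+z. (case z of (x, y) \<Rightarrow> f x y) \<partial>measure_pmf (pair_pmf p q))"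
    by (simp add: nn_integral_pair_pmf')
  also have "\<dots> = (\<integral>\<^sup>+z. (case z of (y, x) \<Rightarrow> f x y) \<partial>measure_pmf (pair_pmf q p))"
    by (subst pair_commute_pmf) (simp add: case_prod_beta')
  also have "\<dots> = (\<integral>\<^sup>+y. \<integral>\<^sup>+x. f x y \<partial>measure_pmf p \<partial>measure_pmf q)"
    by (simp add: nn_integral_pair_pmf')
  finally show ?thesis .
qed

lemma poisson_add:
  assumes "0 < a" "0 < b"
  shows "map_pmf (\<lambda>(i, j). i + j) (pair_pmf (poisson_pmf a) (poisson_pmf b)) = poisson_pmf (a + b)"
proof (rule pmf_eqI)
  fix n :: nat
  have fib: "(\<lambda>(i, j). i + j) -` {n} = (\<lambda>i. (i, n - i)) ` {..n}"
    by (auto simp: image_iff)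
  have inj: "inj_on (\<lambda>i. (i, n - i)) {..n}"
    by (auto simp: inj_on_def)
  have "pmf (map_pmf (\<lambda>(i, j). i + j) (pair_pmf (poisson_pmf a) (poisson_pmf b))) n =
        (\<Sum>i\<le>n. pmf (poisson_pmf a) i * pmf (poisson_pmf b) (n - i))"
    by (simp only: pmf_map fib)
       (subst measure_measure_pmf_finite, auto simp: sum.reindex[OF inj] pmf_pair simp del: pmf_poisson)
  also have "\<dots> = (\<Sum>i\<le>n. (of_nat (n choose i) * a ^ i * b ^ (n - i)) * (exp (-a) * exp (-b) / fact n))"
    using assms by (intro sum.cong refl) (auto simp: binomial_fact field_simps)
  also have "\<dots> = (a + b) ^ n * (exp (-a) * exp (-b) / fact n)"
    by (simp only: binomial_ring sum_distrib_right)
  also have "\<dots> = pmf (poisson_pmf (a + b)) n"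
    using assms by (simp add: field_simps flip: exp_add)
  finally show "pmf (map_pmf (\<lambda>(i, j). i + j) (pair_pmf (poisson_pmf a) (poisson_pmf b))) n =
                pmf (poisson_pmf (a + b)) n" .
qed

lemma nn_integral_poisson0_add:
  assumes "0 \<le> a" "0 \<le> b"
  shows "(\<integral>\<^sup>+n. h n \<partial>measure_pmf (poisson0_pmf (a + b))) =
         (\<integral>\<^sup>+i. \<integral>\<^sup>+j. h (i + j) \<partial>measure_pmf (poisson0_pmf b) \<partial>measure_pmf (poisson0_pmf a))"
proof (cases "a = 0 \<or> b = 0")
  case True
  then show ?thesis by (auto simp: poisson0_pmf_def)
next
  case False
  then have "poisson0_pmf (a + b) =
      map_pmf (\<lambda>(i, j). i + j) (pair_pmf (poisson0_pmf a) (poisson0_pmf b))"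
    using assms poisson_add[of a b] by (simp add: poisson0_pmf_def)
  then show ?thesis by (simp add: nn_integral_pair_pmf' case_prod_beta)
qed

text \<open>
  The orders of rate \<open>d\<close> enter before the first truncation at zero on the left and after it on the
  right. As \<open>(y + u)\<^sup>+ \<le> y\<^sup>+ + u\<close>, postponing them cannot decrease the backlog on any path.
\<close>

lemma period_mean_postpone:
  assumes "mono h" "0 \<le> a" "0 \<le> b" "0 \<le> d"
  shows "period_mean K (poisson0_pmf (a + d)) (period_mean K (poisson0_pmf b) h) x
       \<le> period_mean K (poisson0_pmf a) (period_mean K (poisson0_pmf (d + b)) h) x"
  (is "?l \<le> ?r")
proof -
  let ?A = "measure_pmf (poisson0_pmf a)" and ?B = "measure_pmf (poisson0_pmf b)"
  let ?D = "measure_pmf (poisson0_pmf d)" and ?K = "measure_pmf K"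
  \<comment> \<open>Split off the movable orders \<open>u\<close> and let both sides use the same inputs.\<close>
  have "?l = (\<integral>\<^sup>+e. \<integral>\<^sup>+u. \<integral>\<^sup>+k. \<integral>\<^sup>+e'. \<integral>\<^sup>+k'. h (x + (e + u) - k + e' - k') \<partial>?K \<partial>?B \<partial>?K \<partial>?D \<partial>?A)"
    using assms by (simp add: period_mean_def nn_integral_poisson0_add)
  also have "\<dots> = (\<integral>\<^sup>+e. \<integral>\<^sup>+k. \<integral>\<^sup>+u. \<integral>\<^sup>+e'. \<integral>\<^sup>+k'. h (x + (e + u) - k + e' - k') \<partial>?K \<partial>?B \<partial>?D \<partial>?K \<partial>?A)"
    by (subst nn_integral_pmf_commute) (rule refl)
  also have "\<dots> \<le> (\<integral>\<^sup>+e. \<integral>\<^sup>+k. \<integral>\<^sup>+u. \<integral>\<^sup>+e'. \<integral>\<^sup>+k'. h (x + e - k + (u + e') - k') \<partial>?K \<partial>?B \<partial>?D \<partial>?K \<partial>?A)"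
    by (intro nn_integral_mono monoD[OF assms(1)]) auto
  also have "\<dots> = ?r"
    using assms by (simp add: period_mean_def nn_integral_poisson0_add)
  finally show ?thesis .
qed

section \<open>Earlier orders lead to a smaller final backlog\<close>

definition poisson_mean :: "nat pmf \<Rightarrow> real list \<Rightarrow> (nat \<Rightarrow> ennreal) \<Rightarrow> nat \<Rightarrow> ennreal" where
  "poisson_mean K rs h = foldr (\<lambda>r. period_mean K (poisson0_pmf r)) rs h"

lemma poisson_mean_simps [simp]:
  "poisson_mean K [] h = h"
  "poisson_mean K (r # rs) h = period_mean K (poisson0_pmf r) (poisson_mean K rs h)"
  by (simp_all add: poisson_mean_def)

lemma mono_poisson_mean: "mono h \<Longrightarrow> mono (poisson_mean K rs h)"
  by (induction rs) (auto intro: mono_period_mean)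

text \<open>
  By induction on the horizon: the first rate of \<open>rs\<close> is at least that of \<open>ss\<close>, and postponing the excess
  to the second period makes the first rates equal while the tails still satisfy the hypothesis on
  partial sums. In the last period nothing is left to postpone because the totals agree.
\<close>

lemma poisson_mean_le_if_earlier:
  assumes "mono h" "length rs = length ss"
    and "\<And>r. r \<in> set rs \<Longrightarrow> 0 \<le> r" "\<And>s. s \<in> set ss \<Longrightarrow> 0 \<le> s"
    and "\<And>n. sum_list (take n ss) \<le> sum_list (take n rs)"
    and "sum_list rs = sum_list ss"
  shows "poisson_mean K rs h x \<le> poisson_mean K ss h x"
  using assms(2-)
proof (induction ss arbitrary: rs x)
  case Nil
  then show ?case by simp
next
  case (Cons s ss)
  then obtain r rs' where rs: "rs = r # rs'" by (cases rs) auto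
  have le: "s \<le> r" using Cons.prems(4)[of 1] by (simp add: rs)
  have tails: "sum_list (take n ss) \<le> (r - s) + sum_list (take n rs')" for n
    using Cons.prems(4)[of "Suc n"] by (simp add: rs)
  show ?case
  proof (cases rs')
    case Nil
    then show ?thesis using Cons.prems(1,5) by (simp add: rs)
  next
    case (Cons r' rs'')
    have nonneg: "0 \<le> s" "0 \<le> r'" "\<And>t. t \<in> set rs'' \<Longrightarrow> 0 \<le> t"
      using Cons.prems(2,3) by (auto simp: rs Cons)
    have "poisson_mean K rs h x =
        period_mean K (poisson0_pmf (s + (r - s)))
          (period_mean K (poisson0_pmf r') (poisson_mean K rs'' h)) x"
      by (simp add: rs Cons)
    also have "\<dots> \<le> period_mean K (poisson0_pmf s) (poisson_mean K ((r - s + r') # rs'') h) x"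
      using period_mean_postpone[OF mono_poisson_mean[OF assms(1)] nonneg(1,2), of "r - s"] le
      by simp
    also have "\<dots> \<le> period_mean K (poisson0_pmf s) (poisson_mean K ss h) x"
    proof (intro period_mean_le Cons.IH)
      show "sum_list (take n ss) \<le> sum_list (take n ((r - s + r') # rs''))" for n
      proof (cases n)
        case (Suc m)
        then show ?thesis using tails[of n] by (simp add: Cons)
      qed simp
    qed (use Cons.prems le nonneg in \<open>auto simp: rs Cons\<close>)
    finally show ?thesis by simp
  qed
qed

section \<open>Geometric convergence under an exponential weight\<close>

definition pgf :: "nat pmf \<Rightarrow> real \<Rightarrow> ennreal" where
  "pgf q z = (\<integral>\<^sup>+n. ennreal (z ^ n) \<partial>measure_pmf q)"

lemma pgf_poisson0:
  assumes "0 \<le> r" "0 \<le> z"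
  shows "pgf (poisson0_pmf r) z = ennreal (exp (r * (z - 1)))"
proof (cases "r = 0")
  case True
  then show ?thesis by (simp add: pgf_def poisson0_pmf_def)
next
  case False
  with assms have r: "0 < r" by simp
  have "(\<lambda>n. exp (- r) * ((r * z) ^ n /\<^sub>R fact n)) sums (exp (- r) * exp (r * z))"
    by (intro sums_mult exp_converges)
  moreover have "exp (- r) * ((r * z) ^ n /\<^sub>R fact n) = pmf (poisson_pmf r) n * z ^ n" for n
    using r by (simp add: field_simps power_mult_distrib)
  moreover have "exp (- r) * exp (r * z) = exp (r * (z - 1))"
    by (simp add: algebra_simps flip: exp_add)
  ultimately have sums: "(\<lambda>n. pmf (poisson_pmf r) n * z ^ n) sums exp (r * (z - 1))" by simp
  have "pgf (poisson0_pmf r) z = (\<Sum>n. ennreal (pmf (poisson_pmf r) n * z ^ n))"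
    using False assms
    by (simp add: pgf_def poisson0_pmf_def nn_integral_measure_pmf nn_integral_count_space_nat
        ennreal_mult'' del: pmf_poisson)
  also have "\<dots> = ennreal (\<Sum>n. pmf (poisson_pmf r) n * z ^ n)"
    using sums assms by (intro suminf_ennreal2) (auto simp: sums_iff simp del: pmf_poisson)
  finally show ?thesis using sums by (simp add: sums_iff)
qed

text \<open>
  Besides monotonicity and finiteness, this is the Lipschitz condition with constant \<open>C\<close> for the
  metric \<open>\<bar>z^x - z^y\<bar>\<close>; it is written with an addition because subtraction of extended
  nonnegative reals is truncated. Monotonicity gives the other half of the bound on
  \<open>\<bar>h x - h y\<bar>\<close>.
\<close>

definition weighted_lipschitz :: "real \<Rightarrow> ennreal \<Rightarrow> (nat \<Rightarrow> ennreal) \<Rightarrow> bool" where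
  "weighted_lipschitz z C h \<longleftrightarrow>
     mono h \<and> (\<forall>x. h x < \<infinity>) \<and> (\<forall>x y. y \<le> x \<longrightarrow> h x \<le> h y + C * ennreal (z ^ x - z ^ y))"

text \<open>
  Reflection at zero becomes a maximum with 1 after the exponential change of scale.
\<close>

lemma power_diff_eq_max:
  fixes z :: real
  assumes "1 \<le> z"
  shows "z ^ (m - k) = max 1 (z ^ m * inverse z ^ k)"
proof (cases "k \<le> m")
  case True
  have "1 \<le> z ^ (m - k)" using assms by simp
  moreover have "z ^ (m - k) = z ^ m * inverse z ^ k"
    using True assms by (simp add: power_diff field_simps)
  ultimately show ?thesis by simp
next
  case False
  then have "z ^ m \<le> z ^ k" using assms by (intro power_increasing) auto
  then show ?thesis using False assms by (simp add: field_simps max_def)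
qed

text \<open>
  Without reflection this would be an equality, and taking the maximum with 1 is non-expansive.
\<close>

lemma power_diff_contract:
  fixes z :: real
  assumes "1 \<le> z" "y \<le> x"
  shows "z ^ (x + e - k) - z ^ (y + e - k) \<le> z ^ e * inverse z ^ k * (z ^ x - z ^ y)"
proof -
  have "z ^ y * (z ^ e * inverse z ^ k) \<le> z ^ x * (z ^ e * inverse z ^ k)"
    using assms by (intro mult_right_mono power_increasing) auto
  moreover have "z ^ (m + e) * inverse z ^ k = z ^ m * (z ^ e * inverse z ^ k)" for m
    by (simp add: power_add mult.assoc del: power_inverse)
  moreover have "max 1 (a * c) - max 1 (b * c) \<le> c * (a - b)" if "b * c \<le> a * c" for a b c :: real
    using that by (auto simp: max_def algebra_simps)
  ultimately show ?thesis
    unfolding power_diff_eq_max[OF assms(1)] by metis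
qed

text \<open>
  The two copies of the walk that start in \<open>x\<close> and \<open>y\<close> are driven by the same demand and capacity;
  each path multiplies their weighted distance by at most \<open>z^e * z^(-k)\<close>.
\<close>

lemma weighted_lipschitz_period_mean:
  assumes h: "weighted_lipschitz z C h" and z: "1 \<le> z" and C: "C < \<infinity>" and q: "pgf q z < \<infinity>"
  shows "weighted_lipschitz z (C * (pgf q z * pgf K (inverse z))) (period_mean K q h)"
  unfolding weighted_lipschitz_def
proof (intro conjI allI impI)
  have h_mono: "mono h" and h_fin: "\<And>x. h x < \<infinity>"
    and h_lip: "\<And>x y. y \<le> x \<Longrightarrow> h x \<le> h y + C * ennreal (z ^ x - z ^ y)"
    using h by (auto simp: weighted_lipschitz_def)
  show "mono (period_mean K q h)" by (rule mono_period_mean[OF h_mono])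
  show "period_mean K q h x < \<infinity>" for x
  proof -
    have "h (x + e - k) \<le> h 0 + C * (ennreal (z ^ x) * ennreal (z ^ e))" for e k
    proof -
      have "h (x + e - k) \<le> h (x + e)" by (intro monoD[OF h_mono]) auto
      also have "\<dots> \<le> h 0 + C * ennreal (z ^ (x + e) - z ^ 0)" by (rule h_lip) simp
      also have "\<dots> \<le> h 0 + C * ennreal (z ^ x * z ^ e)"
        by (intro add_left_mono mult_left_mono ennreal_leI) (auto simp: power_add)
      finally show ?thesis using z by (simp add: ennreal_mult)
    qed
    then have "period_mean K q h x \<le>
        (\<integral>\<^sup>+e. \<integral>\<^sup>+k. h 0 + C * (ennreal (z ^ x) * ennreal (z ^ e)) \<partial>measure_pmf K \<partial>measure_pmf q)"
      unfolding period_mean_def by (intro nn_integral_mono)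
    also have "\<dots> = h 0 + C * (ennreal (z ^ x) * pgf q z)"
      by (simp add: nn_integral_add nn_integral_cmult pgf_def)
    also have "\<dots> < \<infinity>"
      using h_fin[of 0] C q by (simp add: ennreal_mult_less_top)
    finally show ?thesis .
  qed
  show "period_mean K q h x \<le> period_mean K q h y +
      C * (pgf q z * pgf K (inverse z)) * ennreal (z ^ x - z ^ y)" if "y \<le> x" for x y
  proof -
    have diff_nonneg: "0 \<le> z ^ x - z ^ y" using power_increasing[OF that z] by simp
    have "h (x + e - k) \<le> h (y + e - k) +
        C * (ennreal (z ^ e) * ennreal (inverse z ^ k)) * ennreal (z ^ x - z ^ y)" for e k
    proof -
      have "h (x + e - k) \<le> h (y + e - k) + C * ennreal (z ^ (x + e - k) - z ^ (y + e - k))"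
        using that by (intro h_lip) auto
      also have "\<dots> \<le> h (y + e - k) + C * ennreal (z ^ e * inverse z ^ k * (z ^ x - z ^ y))"
        by (intro add_left_mono mult_left_mono ennreal_leI power_diff_contract z that) auto
      finally show ?thesis
        using z diff_nonneg by (simp add: ennreal_mult mult.assoc)
    qed
    then have "period_mean K q h x \<le> (\<integral>\<^sup>+e. \<integral>\<^sup>+k. h (y + e - k) +
        C * (ennreal (z ^ e) * ennreal (inverse z ^ k)) * ennreal (z ^ x - z ^ y)
        \<partial>measure_pmf K \<partial>measure_pmf q)"
      unfolding period_mean_def by (intro nn_integral_mono)
    also have "\<dots> = period_mean K q h y +
        C * (pgf q z * pgf K (inverse z)) * ennreal (z ^ x - z ^ y)"
      by (simp add: nn_integral_add nn_integral_cmult nn_integral_multc pgf_def period_mean_def)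
    finally show ?thesis .
  qed
qed

lemma weighted_lipschitz_iterated_period_mean:
  assumes h: "weighted_lipschitz z C h" and z: "1 \<le> z" and C: "C < \<infinity>" and q: "pgf q z < \<infinity>"
    and contraction: "pgf q z * pgf K (inverse z) \<le> 1"
  shows "weighted_lipschitz z (C * (pgf q z * pgf K (inverse z)) ^ n) ((period_mean K q ^^ n) h)"
proof (induction n)
  case 0
  then show ?case using h by simp
next
  case (Suc n)
  have "C * (pgf q z * pgf K (inverse z)) ^ n \<le> C * 1"
    using contraction by (intro mult_left_mono power_le_one) auto
  then have "C * (pgf q z * pgf K (inverse z)) ^ n < \<infinity>" using C by (simp add: le_less_trans)
  from weighted_lipschitz_period_mean[OF Suc z this q, of K] show ?case by (simp add: mult_ac)
qed

text \<open>
  The iterate \<open>n + 1\<close> at \<open>x\<close> averages the iterate \<open>n\<close> over the states reachable from \<open>x\<close> in one period.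
  These states have finite mean weighted distance to \<open>x\<close>, and the iterate \<open>n\<close> has Lipschitz constant
  \<open>C * g^n\<close>, so successive iterates at \<open>x\<close> differ by at most \<open>M * g^n\<close>.
\<close>

lemma convergent_iterated_period_mean:
  assumes h: "weighted_lipschitz z C h" and z: "1 \<le> z" and C: "C < \<infinity>" and q: "pgf q z < \<infinity>"
    and contraction: "pgf q z * pgf K (inverse z) < 1"
  shows "convergent (\<lambda>n. enn2real ((period_mean K q ^^ n) h x))"
proof -
  define g where "g = pgf q z * pgf K (inverse z)"
  define u where "u n = (period_mean K q ^^ n) h" for n
  have g: "g < 1" using contraction by (simp add: g_def)
  have u_lip: "weighted_lipschitz z (C * g ^ n) (u n)" for n
    using weighted_lipschitz_iterated_period_mean[OF h z C q] contraction by (simp add: u_def g_def)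
  have u_fin: "u n y < \<infinity>" for n y using u_lip[of n] by (simp add: weighted_lipschitz_def)
  have u_Suc: "u (Suc n) x = (\<integral>\<^sup>+e. \<integral>\<^sup>+k. u n (x + e - k) \<partial>measure_pmf K \<partial>measure_pmf q)" for n
    by (simp add: u_def period_mean_def)
  define M where "M = C * (ennreal (z ^ x) * (pgf q z + 1))"
  have M: "M < \<infinity>" using C q by (simp add: M_def ennreal_mult_less_top)
  \<comment> \<open>The weighted distance from \<open>y\<close> to any smaller state is at most \<open>z ^ y\<close>.\<close>
  have le_add: "u n y \<le> u n w + C * g ^ n * ennreal (z ^ y)" for n y w
  proof (cases "w \<le> y")
    case True
    then have "u n y \<le> u n w + C * g ^ n * ennreal (z ^ y - z ^ w)"
      using u_lip[of n] by (simp add: weighted_lipschitz_def)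
    also have "\<dots> \<le> u n w + C * g ^ n * ennreal (z ^ y)"
      using z by (intro add_left_mono mult_left_mono ennreal_leI) auto
    finally show ?thesis .
  next
    case False
    then have "u n y \<le> u n w"
      using u_lip[of n] by (auto simp: weighted_lipschitz_def mono_def)
    then show ?thesis by (simp add: add_increasing2)
  qed
  have up: "u (Suc n) x \<le> u n x + M * g ^ n" for n
  proof -
    have "u n (x + e - k) \<le> u n x + C * g ^ n * (ennreal (z ^ x) * ennreal (z ^ e))" for e k
    proof -
      have "u n (x + e - k) \<le> u n x + C * g ^ n * ennreal (z ^ (x + e - k))" by (rule le_add)
      also have "\<dots> \<le> u n x + C * g ^ n * ennreal (z ^ (x + e))"
        using z by (intro add_left_mono mult_left_mono ennreal_leI power_increasing) auto
      finally show ?thesis using z by (simp add: power_add ennreal_mult)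
    qed
    then have "u (Suc n) x \<le> (\<integral>\<^sup>+e. \<integral>\<^sup>+k. u n x + C * g ^ n * (ennreal (z ^ x) * ennreal (z ^ e))
        \<partial>measure_pmf K \<partial>measure_pmf q)"
      unfolding u_Suc by (intro nn_integral_mono)
    also have "\<dots> = u n x + C * g ^ n * (ennreal (z ^ x) * pgf q z)"
      by (simp add: nn_integral_add nn_integral_cmult pgf_def)
    also have "\<dots> \<le> u n x + C * g ^ n * (ennreal (z ^ x) * (pgf q z + 1))"
      by (intro add_left_mono mult_left_mono) auto
    finally show ?thesis by (simp add: M_def mult_ac)
  qed
  have down: "u n x \<le> u (Suc n) x + M * g ^ n" for n
  proof -
    have "u n x = (\<integral>\<^sup>+e. \<integral>\<^sup>+k. u n x \<partial>measure_pmf K \<partial>measure_pmf q)" by simp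
    also have "\<dots> \<le> (\<integral>\<^sup>+e. \<integral>\<^sup>+k. u n (x + e - k) + C * g ^ n * ennreal (z ^ x)
        \<partial>measure_pmf K \<partial>measure_pmf q)"
      by (intro nn_integral_mono le_add)
    also have "\<dots> = u (Suc n) x + C * g ^ n * (ennreal (z ^ x) * 1)"
      by (simp add: nn_integral_add u_Suc)
    also have "\<dots> \<le> u (Suc n) x + C * g ^ n * (ennreal (z ^ x) * (pgf q z + 1))"
      by (intro add_left_mono mult_left_mono) auto
    finally show ?thesis by (simp add: M_def mult_ac)
  qed
  define r where "r n = enn2real (u n x)" for n
  have u_eq: "u n x = ennreal (r n)" for n using u_fin[of n x] by (simp add: r_def)
  have r_nonneg: "0 \<le> r n" for n by (simp add: r_def)
  have Mg_eq: "M * g ^ n = ennreal (enn2real M * enn2real g ^ n)" for n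
  proof -
    have "ennreal (enn2real M) = M" "ennreal (enn2real g) = g"
      using M less_le_trans[OF g, of top] by simp_all
    then show ?thesis by (simp add: ennreal_mult flip: ennreal_power)
  qed
  have bound: "norm (r (Suc n) - r n) \<le> enn2real M * enn2real g ^ n" for n
  proof -
    have "ennreal (r (Suc n)) \<le> ennreal (r n + enn2real M * enn2real g ^ n)"
      using up[of n] r_nonneg by (simp add: u_eq Mg_eq)
    moreover have "ennreal (r n) \<le> ennreal (r (Suc n) + enn2real M * enn2real g ^ n)"
      using down[of n] r_nonneg by (simp add: u_eq Mg_eq)
    ultimately show ?thesis
      using r_nonneg by (subst (asm) (1 2) ennreal_le_iff) auto
  qed
  have "enn2real g < 1" using g by (cases g) (auto simp: ennreal_less_iff ennreal_1[symmetric] simp del: ennreal_1)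
  then have "summable (\<lambda>n. enn2real M * enn2real g ^ n)"
    by (intro summable_mult summable_geometric) simp
  then have "summable (\<lambda>n. r (Suc n) - r n)"
    by (rule summable_comparison_test'[where N = 0]) (rule bound)
  then have "convergent (\<lambda>n. r n - r 0)"
    by (simp add: summable_iff_convergent sum_lessThan_telescope)
  then have "convergent r" by (simp add: convergent_diff_const_right_iff)
  then show ?thesis by (simp add: r_def[abs_def] u_def)
qed

text \<open>
  The powers of \<open>z\<close> grow by at least \<open>z - 1\<close> from one exponent to the next.
\<close>

lemma weighted_lipschitz_real:
  assumes "1 < z"
  shows "weighted_lipschitz z (ennreal (1 / (z - 1))) (\<lambda>x. ennreal (real x))"
  unfolding weighted_lipschitz_def
proof (intro conjI allI impI)
  show "mono (\<lambda>x. ennreal (real x))" by (auto intro!: monoI ennreal_leI)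
  show "ennreal (real x) < \<infinity>" for x by simp
  show "ennreal (real x) \<le> ennreal (real y) + ennreal (1 / (z - 1)) * ennreal (z ^ x - z ^ y)"
    if "y \<le> x" for x y
  proof -
    have "(z - 1) * (real x - real y) \<le> z ^ x - z ^ y"
      using that
    proof (induction x rule: dec_induct)
      case (step n)
      have "(z - 1) * 1 \<le> (z - 1) * z ^ n" using assms by (intro mult_left_mono) auto
      with step.IH show ?case by (simp add: algebra_simps)
    qed simp
    then have "real x \<le> real y + 1 / (z - 1) * (z ^ x - z ^ y)"
      using assms by (simp add: field_simps)
    moreover have "0 \<le> z ^ x - z ^ y" using power_increasing[OF that, of z] assms by simp
    ultimately show ?thesis
      using assms by (simp add: ennreal_leI flip: ennreal_mult ennreal_plus)
  qed
qed

lemma pgf_inverse_le_1: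
  assumes "1 \<le> z"
  shows "pgf K (inverse z) \<le> 1"
proof -
  have "pgf K (inverse z) \<le> (\<integral>\<^sup>+k. 1 \<partial>measure_pmf K)"
    unfolding pgf_def using assms
    by (intro nn_integral_mono) (auto intro!: power_le_one simp: inverse_le_1_iff)
  then show ?thesis by simp
qed

lemma weighted_lipschitz_poisson_mean:
  assumes h: "weighted_lipschitz z C h" and z: "1 \<le> z" and C: "C < \<infinity>"
    and rs: "\<And>r. r \<in> set rs \<Longrightarrow> 0 \<le> r"
  shows "\<exists>C'<\<infinity>. weighted_lipschitz z C' (poisson_mean K rs h)"
  using rs
proof (induction rs)
  case Nil
  then show ?case using h C by auto
next
  case (Cons r rs)
  then obtain C' where C': "C' < \<infinity>" "weighted_lipschitz z C' (poisson_mean K rs h)" by auto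
  have fin: "pgf (poisson0_pmf r) z < \<infinity>" using Cons.prems z by (simp add: pgf_poisson0)
  have "pgf K (inverse z) < \<infinity>" using pgf_inverse_le_1[OF z, of K] by (simp add: le_less_trans)
  then have "C' * (pgf (poisson0_pmf r) z * pgf K (inverse z)) < \<infinity>"
    using C'(1) fin by (simp add: ennreal_mult_less_top)
  then show ?case
    using weighted_lipschitz_period_mean[OF C'(2) z C'(1) fin, of K] by auto
qed

section \<open>Stability provides a contracting weight\<close>

text \<open>
  Capacity is truncated because its mean may be infinite, whereas the expansion to second order in
  \<open>exists_contraction_weight\<close> needs a bounded variable.
\<close>

lemma truncated_mean_exceeds:
  assumes "0 < lam" "traffic_intensity lam K < 1"
  obtains n where "lam < (\<integral>k. real (min k n) \<partial>measure_pmf K)"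
proof -
  let ?m = "\<integral>\<^sup>+k. of_nat k \<partial>measure_pmf K"
  have "ennreal lam < ?m"
  proof (rule ccontr)
    assume "\<not> ennreal lam < ?m"
    then have le: "?m \<le> ennreal lam" by simp
    have "1 \<le> ennreal lam / ?m"
    proof (cases "?m = 0")
      case True
      then show ?thesis using assms(1) by (simp add: ennreal_divide_zero)
    next
      case False
      then have "1 = ?m / ?m"
        using le by (subst ennreal_divide_self) (auto simp: le_less_trans[OF _ ennreal_less_top])
      also have "\<dots> \<le> ennreal lam / ?m" by (rule divide_right_mono_ennreal[OF le])
      finally show ?thesis .
    qed
    then show False using assms(2) by (simp add: traffic_intensity_def)
  qed
  also have "?m = (\<integral>\<^sup>+k. (SUP n. of_nat (min k n)) \<partial>measure_pmf K)"
  proof (intro nn_integral_cong)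
    show "of_nat k = (SUP n. of_nat (min k n) :: ennreal)" for k
      by (intro antisym SUP_least SUP_upper2[of k]) auto
  qed
  also have "\<dots> = (SUP n. \<integral>\<^sup>+k. of_nat (min k n) \<partial>measure_pmf K)"
    by (intro nn_integral_monotone_convergence_SUP) (auto simp: incseq_def le_fun_def)
  finally obtain n where n: "ennreal lam < (\<integral>\<^sup>+k. of_nat (min k n) \<partial>measure_pmf K)"
    by (auto simp: less_SUP_iff)
  have "(\<integral>\<^sup>+k. of_nat (min k n) \<partial>measure_pmf K) = ennreal (\<integral>k. real (min k n) \<partial>measure_pmf K)"
    by (subst nn_integral_eq_integral[symmetric])
       (auto intro!: measure_pmf.integrable_const_bound[where B = "real n"] simp: ennreal_of_nat_eq_real_of_nat)
  with n show ?thesis using assms(1) by (intro that) (auto simp: ennreal_less_iff)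
qed

text \<open>
  Let \<open>m > lam\<close> be the mean of the capacity truncated at \<open>n\<close>, and \<open>z = 1 + d\<close>. The generating function
  of the demand is \<open>exp (lam * d)\<close>, and that of the capacity at \<open>1 / z\<close> is at most
  \<open>1 - m * d + (d * n)^2\<close>. As soon as \<open>d * n^2 < m - lam\<close>, the latter is below
  \<open>1 - lam * d \<le> exp (- lam * d)\<close>, so the product is below 1.
\<close>

lemma exists_contraction_weight:
  assumes "0 < lam" "traffic_intensity lam K < 1"
  obtains z where "1 < z" "pgf (poisson0_pmf lam) z * pgf K (inverse z) < 1"
proof -
  obtain n where n: "lam < (\<integral>k. real (min k n) \<partial>measure_pmf K)"
    using truncated_mean_exceeds[OF assms] .
  define m where "m = (\<integral>k. real (min k n) \<partial>measure_pmf K)"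
  define d where "d = (m - lam) / (real n ^ 2 + 1)"
  have d: "0 < d" using n by (simp add: d_def m_def add_nonneg_pos)
  have int: "integrable (measure_pmf K) (\<lambda>k. real (min k n))"
    by (auto intro!: measure_pmf.integrable_const_bound[where B = "real n"])
  \<comment> \<open>Bernoulli's inequality, followed by \<open>1 / (1 + v) \<le> 1 - v + v^2\<close> for \<open>v \<ge> 0\<close>.\<close>
  have pointwise: "inverse (1 + d) ^ k \<le> 1 - d * real (min k n) + (d * real n) ^ 2" for k
  proof -
    let ?v = "d * real (min k n)"
    have v: "0 \<le> ?v" "?v \<le> d * real n" using d by (auto intro!: mult_left_mono)
    have "inverse (1 + d) ^ k \<le> inverse (1 + d) ^ min k n"
      using d by (intro power_decreasing) (auto simp: inverse_le_1_iff)
    also have "\<dots> = inverse ((1 + d) ^ min k n)" by (rule power_inverse)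
    also have "\<dots> \<le> inverse (1 + ?v)"
      using Bernoulli_inequality[of d "min k n"] d v
      by (intro le_imp_inverse_le add_pos_nonneg) (auto simp: mult.commute)
    also have "\<dots> \<le> 1 - ?v + ?v ^ 2"
    proof -
      have "(1 - ?v + ?v ^ 2) * (1 + ?v) = 1 + ?v ^ 3"
        by (simp add: power2_eq_square power3_eq_cube algebra_simps)
      then have "1 \<le> (1 - ?v + ?v ^ 2) * (1 + ?v)" using v by simp
      then show ?thesis using v by (simp add: inverse_eq_divide pos_divide_le_eq)
    qed
    also have "?v ^ 2 \<le> (d * real n) ^ 2" using v by (intro power_mono)
    finally show ?thesis by simp
  qed
  have "pgf K (inverse (1 + d)) \<le> (\<integral>\<^sup>+k. ennreal (1 - d * real (min k n) + (d * real n) ^ 2) \<partial>measure_pmf K)"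
    unfolding pgf_def by (intro nn_integral_mono ennreal_leI pointwise)
  also have "\<dots> = ennreal (\<integral>k. 1 - d * real (min k n) + (d * real n) ^ 2 \<partial>measure_pmf K)"
  proof (rule nn_integral_eq_integral)
    have "0 \<le> 1 - d * real (min k n) + (d * real n) ^ 2" for k
      using pointwise[of k] d by (meson zero_le_power inverse_nonnegative_iff_nonnegative
          add_nonneg_nonneg zero_le_one less_imp_le order_trans)
    then show "AE k in measure_pmf K. 0 \<le> 1 - d * real (min k n) + (d * real n) ^ 2" by simp
  qed (intro Bochner_Integration.integrable_add Bochner_Integration.integrable_diff
      integrable_mult_right int, auto)
  also have "(\<integral>k. 1 - d * real (min k n) + (d * real n) ^ 2 \<partial>measure_pmf K) = 1 - d * m + (d * real n) ^ 2"
    using int by (simp add: m_def)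
  finally have K: "pgf K (inverse (1 + d)) \<le> ennreal (1 - d * m + (d * real n) ^ 2)" .
  have "d * (real n)\<^sup>2 < d * (real n ^ 2 + 1)" using d by simp
  also have "\<dots> = m - lam" by (simp add: d_def add_nonneg_eq_0_iff)
  finally have "d * (d * (real n)\<^sup>2) < d * (m - lam)" using d by simp
  then have "1 - d * m + (d * real n) ^ 2 < 1 - lam * d"
    by (simp add: power_mult_distrib power2_eq_square algebra_simps)
  also have "\<dots> \<le> exp (- (lam * d))" using exp_ge_add_one_self[of "- (lam * d)"] by simp
  finally have less: "1 - d * m + (d * real n) ^ 2 < exp (- (lam * d))" .
  have "pgf (poisson0_pmf lam) (1 + d) * pgf K (inverse (1 + d))
      \<le> ennreal (exp (lam * d)) * ennreal (1 - d * m + (d * real n) ^ 2)"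
    using assms(1) d K by (simp add: pgf_poisson0 mult_left_mono)
  also have "\<dots> = ennreal (exp (lam * d) * (1 - d * m + (d * real n) ^ 2))"
    by (simp add: ennreal_mult')
  also have "\<dots> < 1"
  proof -
    have "exp (lam * d) * (1 - d * m + (d * real n) ^ 2) < exp (lam * d) * exp (- (lam * d))"
      using less by simp
    also have "\<dots> = 1" by (simp flip: exp_add)
    finally show ?thesis by (simp add: ennreal_less_one_iff)
  qed
  finally show ?thesis using d by (intro that[of "1 + d"]) auto
qed

section \<open>Expectations along a chain driven by independent inputs\<close>

primrec state_path :: "(nat \<Rightarrow> nat \<Rightarrow> 'a \<Rightarrow> nat) \<Rightarrow> nat \<Rightarrow> (nat \<Rightarrow> 'a) \<Rightarrow> nat \<Rightarrow> nat" where
  "state_path F x \<omega> 0 = x"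
| "state_path F x \<omega> (Suc t) = F t (state_path F x \<omega> t) (\<omega> t)"

lemma state_path_cong:
  "(\<And>t. t < n \<Longrightarrow> \<omega> t = \<omega>' t) \<Longrightarrow> state_path F x \<omega> n = state_path F x \<omega>' n"
  by (induction n) auto

lemma measurable_state_path:
  assumes "{..<n} \<subseteq> I"
  shows "(\<lambda>\<omega>. state_path F x \<omega> n) \<in> (\<Pi>\<^sub>M t\<in>I. measure_pmf (p t)) \<rightarrow>\<^sub>M count_space UNIV"
  using assms
proof (induction n)
  case (Suc n)
  have IH: "(\<lambda>\<omega>. state_path F x \<omega> n) \<in> (\<Pi>\<^sub>M t\<in>I. measure_pmf (p t)) \<rightarrow>\<^sub>M count_space UNIV"
    using Suc by (simp add: lessThan_Suc)
  have "(\<lambda>\<omega>. F n y (\<omega> n)) \<in> (\<Pi>\<^sub>M t\<in>I. measure_pmf (p t)) \<rightarrow>\<^sub>M count_space UNIV" for y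
    using Suc.prems
    by (intro measurable_compose[OF measurable_component_singleton]) auto
  then show ?case
    unfolding state_path.simps by (rule measurable_compose_countable[OF _ IH])
qed simp

text \<open>
  The last input is independent of the state that it acts on, which depends on earlier inputs only.
  Integrating it out first turns the expectation into one with a shorter horizon.
\<close>

lemma nn_integral_state_path:
  "(\<integral>\<^sup>+\<omega>. h (state_path F x \<omega> n) \<partial>(\<Pi>\<^sub>M t\<in>UNIV. measure_pmf (p t))) =
   foldr (\<lambda>t h y. \<integral>\<^sup>+a. h (F t y a) \<partial>measure_pmf (p t)) [0..<n] h x"
proof -
  interpret product_prob_space "\<lambda>t. measure_pmf (p t)" UNIV
    by unfold_locales
  \<comment> \<open>The path up to time \<open>n\<close> lives on a finite product, where Fubini's theorem removes one factor.\<close>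
  have fin: "(\<integral>\<^sup>+\<omega>. h (state_path F x \<omega> n) \<partial>(\<Pi>\<^sub>M t\<in>{..<n}. measure_pmf (p t))) =
    foldr (\<lambda>t h y. \<integral>\<^sup>+a. h (F t y a) \<partial>measure_pmf (p t)) [0..<n] h x" for h
  proof (induction n arbitrary: h)
    case 0
    show ?case by (simp add: nn_integral_const prob_space.emeasure_space_1 prob_space_PiM measure_pmf.prob_space_axioms)
  next
    case (Suc n)
    have meas: "(\<lambda>\<omega>. h (state_path F x \<omega> (Suc n))) \<in>
        borel_measurable (\<Pi>\<^sub>M t\<in>insert n {..<n}. measure_pmf (p t))"
      by (rule measurable_compose[OF measurable_state_path]) (auto simp: lessThan_Suc)
    have "(\<integral>\<^sup>+\<omega>. h (state_path F x \<omega> (Suc n)) \<partial>(\<Pi>\<^sub>M t\<in>insert n {..<n}. measure_pmf (p t))) =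
      (\<integral>\<^sup>+\<omega>. \<integral>\<^sup>+a. h (state_path F x (fun_upd \<omega> n a) (Suc n)) \<partial>measure_pmf (p n)
         \<partial>(\<Pi>\<^sub>M t\<in>{..<n}. measure_pmf (p t)))"
      by (intro product_nn_integral_insert meas) auto
    also have "\<dots> = (\<integral>\<^sup>+\<omega>. \<integral>\<^sup>+a. h (F n (state_path F x \<omega> n) a) \<partial>measure_pmf (p n)
         \<partial>(\<Pi>\<^sub>M t\<in>{..<n}. measure_pmf (p t)))"
      using state_path_cong[of n "fun_upd \<omega> n a" \<omega> F x for \<omega> a] by simp
    finally show ?case
      using Suc[of "\<lambda>y. \<integral>\<^sup>+a. h (F n y a) \<partial>measure_pmf (p n)"] by (simp add: lessThan_Suc)
  qed
  have "(\<integral>\<^sup>+\<omega>. h (state_path F x \<omega> n) \<partial>(\<Pi>\<^sub>M t\<in>{..<n}. measure_pmf (p t))) =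
     (\<integral>\<^sup>+\<omega>. h (state_path F x \<omega> n) \<partial>distr (\<Pi>\<^sub>M t\<in>UNIV. measure_pmf (p t)) (\<Pi>\<^sub>M t\<in>{..<n}. measure_pmf (p t))
        (\<lambda>\<omega>. restrict \<omega> {..<n}))"
    by (subst distr_PiM_restrict_finite) auto
  also have "\<dots> = (\<integral>\<^sup>+\<omega>. h (state_path F x (restrict \<omega> {..<n}) n) \<partial>(\<Pi>\<^sub>M t\<in>UNIV. measure_pmf (p t)))"
    by (intro nn_integral_distr measurable_restrict_subset)
       (auto intro: measurable_compose[OF measurable_state_path[OF order_refl]])
  also have "\<dots> = (\<integral>\<^sup>+\<omega>. h (state_path F x \<omega> n) \<partial>(\<Pi>\<^sub>M t\<in>UNIV. measure_pmf (p t)))"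
    using state_path_cong[of n "restrict \<omega> {..<n}" \<omega> F x for \<omega>] by simp
  finally show ?thesis using fin by simp
qed

section \<open>Backorders of a cycle as the state of one chain\<close>

lemma iterated_period_mean_le:
  assumes "\<And>y. h y \<le> h' y"
  shows "(period_mean K q ^^ n) h x \<le> (period_mean K q ^^ n) h' x"
  using assms by (induction n arbitrary: x) (auto intro: period_mean_le)

definition express_rate :: "real \<Rightarrow> real \<Rightarrow> real \<Rightarrow> policy \<Rightarrow> nat \<Rightarrow> real" where
  "express_rate U_min U_max lam \<pi> \<tau> =
     (if \<tau> \<le> fst \<pi> then express_share U_min U_max (snd \<pi> \<tau>) * lam else 0)"

lemma express_law_eq:
  "express_law U_min U_max lam \<pi> \<tau> = poisson0_pmf (express_rate U_min U_max lam \<pi> \<tau>)"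
  by (simp add: express_law_def express_rate_def poisson0_pmf_def)

text \<open>
  So total demand has rate \<open>lam\<close> at every age.
\<close>

lemma normal_law_eq:
  "normal_law U_min U_max lam \<pi> \<tau> = poisson0_pmf (lam - express_rate U_min U_max lam \<pi> \<tau>)"
  by (simp add: normal_law_def express_rate_def algebra_simps)

lemma express_rate_bounds:
  assumes "\<pi> \<in> policies T U_min U_max" "U_min < U_max" "0 \<le> lam"
  shows "0 \<le> express_rate U_min U_max lam \<pi> \<tau>" "express_rate U_min U_max lam \<pi> \<tau> \<le> lam"
proof -
  have "0 \<le> express_share U_min U_max (snd \<pi> \<tau>) \<and> express_share U_min U_max (snd \<pi> \<tau>) \<le> 1"
    if "\<tau> \<le> fst \<pi>"
    using assms that by (auto simp: policies_def express_share_def)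
  then show "0 \<le> express_rate U_min U_max lam \<pi> \<tau>" "express_rate U_min U_max lam \<pi> \<tau> \<le> lam"
    using assms(3) by (auto simp: express_rate_def mult_left_le_one_le)
qed

text \<open>
  The step for backorders of the cycle that starts at time \<open>s\<close>: at the start of a cycle all
  outstanding orders have the same priority, so normal orders placed before \<open>s\<close> count as well,
  while those placed later do not.
\<close>

definition cycle_step :: "nat \<Rightarrow> nat \<Rightarrow> nat \<Rightarrow> nat \<times> nat \<times> nat \<Rightarrow> nat" where
  "cycle_step s t y a = (case a of (e, n, k) \<Rightarrow> y + (if t < s then e + n else e) - k)"

lemma total_backlog_eq_state_path:
  "t \<le> s \<Longrightarrow> total_backlog x \<omega> t = state_path (cycle_step s) x \<omega> t"
  by (induction t)
     (auto simp: cycle_step_def express_orders_def normal_orders_def capacity_def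
        case_prod_beta)

text \<open>
  Only the initial state can violate this, which is why the first cycle is excluded; a single cycle
  does not affect the long-run average.
\<close>

lemma express_backlog_cycle_start:
  assumes "1 \<le> T" "1 \<le> l"
  shows "express_backlog T xh x \<omega> (l * T) = total_backlog x \<omega> (l * T)"
proof -
  obtain l' T' where "l = Suc l'" and T: "T = Suc T'" using assms by (cases l; cases T) auto
  then have eq: "l * T = Suc (l' * T + T')" by simp
  have "(l' * T + T') mod T = T' mod T" by simp
  also have "\<dots> = T - 1" by (simp add: T)
  finally have "(l' * T + T') mod T = T - 1" .
  then show ?thesis by (simp only: eq express_backlog.simps total_backlog.simps) simp
qed

lemma express_backlog_eq_state_path:
  assumes "1 \<le> T" "1 \<le> l" "s < T"
  shows "express_backlog T xh x \<omega> (l * T + s) = state_path (cycle_step (l * T)) x \<omega> (l * T + s)"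
  using assms(3)
proof (induction s)
  case 0
  then show ?case
    using express_backlog_cycle_start[OF assms(1,2)] total_backlog_eq_state_path[of "l * T" "l * T"] by simp
next
  case (Suc s)
  then have "(l * T + s) mod T \<noteq> T - 1" by simp
  with Suc show ?case
    by (simp add: cycle_step_def express_orders_def capacity_def case_prod_beta)
qed

lemma cycle_backorders_eq_state_path:
  assumes "1 \<le> T" "1 \<le> l"
  shows "cycle_backorders T xh x \<omega> l = state_path (cycle_step (l * T)) x \<omega> (l * T + T)"
proof -
  obtain T' where T: "T = Suc T'" using assms(1) by (cases T) auto
  have "state_path (cycle_step (l * T)) x \<omega> (l * T + T) =
      express_backlog T xh x \<omega> (l * T + T') + fst (\<omega> (l * T + T')) - snd (snd (\<omega> (l * T + T')))"
    using express_backlog_eq_state_path[OF assms, of T' xh x \<omega>]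
    by (simp add: T cycle_step_def case_prod_beta)
  then show ?thesis
    by (simp add: T cycle_backorders_def Let_def express_orders_def capacity_def)
qed

lemma nn_integral_cycle_step:
  assumes "0 \<le> r" "r \<le> lam"
  shows "(\<integral>\<^sup>+a. h (cycle_step s t y a)
      \<partial>measure_pmf (pair_pmf (poisson0_pmf r) (pair_pmf (poisson0_pmf (lam - r)) K))) =
    period_mean K (poisson0_pmf (if t < s then lam else r)) h y"
proof (cases "t < s")
  case True
  then show ?thesis
    using assms nn_integral_poisson0_add[of r "lam - r"]
    by (simp add: nn_integral_pair_pmf' cycle_step_def period_mean_def add.assoc)
next
  case False
  then show ?thesis
    by (simp add: nn_integral_pair_pmf' cycle_step_def period_mean_def)
qed

text \<open>
  The policy enters through the last \<open>T\<close> periods only.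
\<close>

lemma nn_integral_cycle_backorders:
  assumes "\<pi> \<in> policies T U_min U_max" "U_min < U_max" "0 \<le> lam" "1 \<le> T" "1 \<le> l"
  shows "(\<integral>\<^sup>+\<omega>. ennreal (real (cycle_backorders T xh x \<omega> l)) \<partial>outcome_measure T U_min U_max lam K \<pi>) =
    (period_mean K (poisson0_pmf lam) ^^ (l * T))
      (poisson_mean K (map (express_rate U_min U_max lam \<pi>) [0..<T]) (\<lambda>y. ennreal (real y))) x"
proof -
  let ?r = "express_rate U_min U_max lam \<pi>" and ?id = "\<lambda>y. ennreal (real y)"
  let ?G = "\<lambda>t. period_mean K (poisson0_pmf (if t < l * T then lam else ?r (t mod T)))"
  have iterate: "foldr (\<lambda>t. period_mean K q) [0..<n] h = (period_mean K q ^^ n) h" for q n h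
    by (induction n arbitrary: h) (auto simp: funpow_swap1)
  have "(\<integral>\<^sup>+\<omega>. ennreal (real (cycle_backorders T xh x \<omega> l)) \<partial>outcome_measure T U_min U_max lam K \<pi>) =
      foldr ?G [0..<l * T + T] ?id x"
    using express_rate_bounds[OF assms(1-3)]
    by (simp add: cycle_backorders_eq_state_path[OF assms(4,5)] outcome_measure_def express_law_eq
        normal_law_eq nn_integral_state_path[where h = ?id] nn_integral_cycle_step)
  also have "\<dots> = foldr ?G [0..<l * T] (foldr ?G [l * T..<l * T + T] ?id) x"
    by (simp only: upt_add_eq_append[OF le0] foldr_append o_apply)
  also have "foldr ?G [l * T..<l * T + T] ?id = poisson_mean K (map ?r [0..<T]) ?id"
  proof -
    have "[l * T..<l * T + T] = map (\<lambda>i. i + l * T) [0..<T]"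
      by (simp add: map_add_upt add.commute)
    then show ?thesis by (auto simp: poisson_mean_def foldr_map intro!: foldr_cong)
  qed
  also have "foldr ?G [0..<l * T] (poisson_mean K (map ?r [0..<T]) ?id) =
      foldr (\<lambda>t. period_mean K (poisson0_pmf lam)) [0..<l * T] (poisson_mean K (map ?r [0..<T]) ?id)"
    by (intro foldr_cong) auto
  finally show ?thesis by (simp add: iterate)
qed

section \<open>Long-run average backorders\<close>

lemma cesaro_mean_tendsto:
  fixes b :: "nat \<Rightarrow> real"
  assumes "b \<longlonglongrightarrow> B"
  shows "(\<lambda>n. 1 / real n * (\<Sum>l<n. b l)) \<longlonglongrightarrow> B"
proof (rule LIMSEQ_I)
  fix e :: real
  assume e: "0 < e"
  obtain N where N: "\<And>l. N \<le> l \<Longrightarrow> norm (b l - B) < e / 2"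
    using LIMSEQ_D[OF assms, of "e / 2"] e by auto
  define S where "S = (\<Sum>l<N. norm (b l - B))"
  obtain N' :: nat where N': "2 * S / e < real N'" using reals_Archimedean2 by blast
  show "\<exists>n0. \<forall>n\<ge>n0. norm (1 / real n * (\<Sum>l<n. b l) - B) < e"
  proof (intro exI[of _ "Suc (N + N')"] allI impI)
    fix n
    assume n: "Suc (N + N') \<le> n"
    have "norm (\<Sum>l<n. b l - B) \<le> (\<Sum>l<n. norm (b l - B))" by (rule norm_sum)
    also have "\<dots> = S + (\<Sum>l=N..<n. norm (b l - B))"
      using n sum.atLeastLessThan_concat[of 0 N n "\<lambda>l. norm (b l - B)"]
      by (simp add: S_def lessThan_atLeast0)
    also have "\<dots> \<le> S + (\<Sum>l=N..<n. e / 2)"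
      by (intro add_left_mono sum_mono less_imp_le[OF N]) auto
    also have "\<dots> \<le> S + real n * (e / 2)"
      using e n by (auto intro!: mult_right_mono)
    also have "\<dots> < real n * e"
    proof -
      have "2 * S < real N' * e" using N' e by (simp add: field_simps)
      also have "\<dots> \<le> real n * e" using n e by (intro mult_right_mono) auto
      finally show ?thesis by simp
    qed
    finally have "norm (\<Sum>l<n. b l - B) < real n * e" .
    moreover have "1 / real n * (\<Sum>l<n. b l) - B = (\<Sum>l<n. b l - B) / real n"
      using n by (simp add: sum_subtractf field_simps)
    ultimately show "norm (1 / real n * (\<Sum>l<n. b l) - B) < e"
      using n by (simp add: pos_divide_less_eq mult.commute)
  qed
qed

text \<open>
  Cycle \<open>0\<close> may have a different initial express backlog, so the mean backorders agree with the
  iterates only from cycle 1 on; this suffices for the limit. Finiteness of the iterates lets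
  inequalities between them be transferred to real numbers.
\<close>

lemma mean_backorders_limit:
  assumes "\<pi> \<in> policies T U_min U_max" "U_min < U_max" "0 < lam" "1 \<le> T"
    "traffic_intensity lam K < 1"
  defines "v \<equiv> poisson_mean K (map (express_rate U_min U_max lam \<pi>) [0..<T]) (\<lambda>y. ennreal (real y))"
  shows "(\<lambda>l. enn2real ((period_mean K (poisson0_pmf lam) ^^ (l * T)) v x))
      \<longlonglongrightarrow> mean_backorders T U_min U_max lam K xh x \<pi>"
    and "(period_mean K (poisson0_pmf lam) ^^ n) v x < \<infinity>"
proof -
  obtain z where z: "1 < z" and contraction: "pgf (poisson0_pmf lam) z * pgf K (inverse z) < 1"
    using exists_contraction_weight[OF assms(3,5)] .
  have z1: "1 \<le> z" using z by simp
  have fin: "pgf (poisson0_pmf lam) z < \<infinity>" using assms(3) z by (simp add: pgf_poisson0)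
  have "0 \<le> r" if "r \<in> set (map (express_rate U_min U_max lam \<pi>) [0..<T])" for r
    using that express_rate_bounds(1)[OF assms(1,2)] assms(3) by auto
  then obtain C where C: "C < \<infinity>" "weighted_lipschitz z C v"
    using weighted_lipschitz_poisson_mean[OF weighted_lipschitz_real[OF z] z1,
        of "map (express_rate U_min U_max lam \<pi>) [0..<T]" K]
    unfolding v_def by auto
  show "(period_mean K (poisson0_pmf lam) ^^ n) v x < \<infinity>"
    using weighted_lipschitz_iterated_period_mean[OF C(2) z1 C(1) fin less_imp_le[OF contraction]]
    by (simp add: weighted_lipschitz_def)
  let ?u = "\<lambda>n. enn2real ((period_mean K (poisson0_pmf lam) ^^ n) v x)"
  obtain B where B: "?u \<longlonglongrightarrow> B"
    using convergent_iterated_period_mean[OF C(2) z1 C(1) fin contraction] by (auto simp: convergent_def)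
  have "strict_mono (\<lambda>l. l * T)" using assms(4) by (auto simp: strict_mono_def)
  from LIMSEQ_subseq_LIMSEQ[OF B this] have u: "(\<lambda>l. ?u (l * T)) \<longlonglongrightarrow> B" by (simp add: o_def)
  let ?b = "\<lambda>l. \<integral>\<omega>. real (cycle_backorders T xh x \<omega> l) \<partial>outcome_measure T U_min U_max lam K \<pi>"
  have "?u (l * T) = ?b l" if "1 \<le> l" for l
  proof -
    have "(\<lambda>\<omega>. real (cycle_backorders T xh x \<omega> l)) \<in>
        borel_measurable (outcome_measure T U_min U_max lam K \<pi>)"
      unfolding cycle_backorders_eq_state_path[OF assms(4) that] outcome_measure_def
      by (rule measurable_compose[OF measurable_state_path]) auto
    then have "?b l = enn2real (\<integral>\<^sup>+\<omega>. ennreal (real (cycle_backorders T xh x \<omega> l))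
        \<partial>outcome_measure T U_min U_max lam K \<pi>)"
      by (intro integral_eq_nn_integral) auto
    then show ?thesis
      using nn_integral_cycle_backorders[OF assms(1,2) less_imp_le[OF assms(3)] assms(4) that]
      by (simp add: v_def)
  qed
  then have "eventually (\<lambda>l. ?u (l * T) = ?b l) sequentially"
    by (rule eventually_sequentiallyI)
  with u have "?b \<longlonglongrightarrow> B" by (rule Lim_transform_eventually)
  then have "mean_backorders T U_min U_max lam K xh x \<pi> = B"
    unfolding mean_backorders_def by (intro limI cesaro_mean_tendsto)
  with u show "(\<lambda>l. ?u (l * T)) \<longlonglongrightarrow> mean_backorders T U_min U_max lam K xh x \<pi>" by simp
qed

section \<open>Comparison of policies\<close>

text \<open>
  Partial sums of express rates are decreasing affine functions of partial sums of fees. They stay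
  constant after the cutoff point.
\<close>

lemma sum_list_take_express_rate:
  assumes "c < T" "U_min < U_max"
  shows "sum_list (take n (map (express_rate U_min U_max lam (c, f)) [0..<T])) =
    lam / (U_max - U_min) * (real (min n (Suc c)) * U_max - (\<Sum>j<min n (Suc c). f j))"
proof -
  have "take n [0..<T] = [0..<min n T]"
    by (cases "n \<le> T") (auto simp: min_def)
  then have "sum_list (take n (map (express_rate U_min U_max lam (c, f)) [0..<T])) =
      (\<Sum>j<min n T. express_rate U_min U_max lam (c, f) j)"
    by (simp add: take_map interv_sum_list_conv_sum_set_nat atLeast0LessThan)
  also have "\<dots> = (\<Sum>j<min n (Suc c). express_rate U_min U_max lam (c, f) j)"
    using assms(1) by (intro sum.mono_neutral_right) (auto simp: express_rate_def)
  also have "\<dots> = (\<Sum>j<min n (Suc c). lam / (U_max - U_min) * (U_max - f j))"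
    by (intro sum.cong) (auto simp: express_rate_def express_share_def)
  also have "\<dots> = lam / (U_max - U_min) * (real (min n (Suc c)) * U_max - (\<Sum>j<min n (Suc c). f j))"
    by (simp only: sum_distrib_left[symmetric] sum_subtractf) simp
  finally show ?thesis .
qed

lemma mean_backorders_le_if_cheaper_earlier:
  assumes "(c, f) \<in> policies T U_min U_max" "(c, f') \<in> policies T U_min U_max"
    and "U_min < U_max" "0 < lam" "traffic_intensity lam K < 1"
    and prefix: "\<And>n. n \<le> c \<Longrightarrow> (\<Sum>j<n. f j) \<le> (\<Sum>j<n. f' j)"
    and total: "(\<Sum>j\<le>c. f j) = (\<Sum>j\<le>c. f' j)"
  shows "mean_backorders T U_min U_max lam K xh x (c, f)
       \<le> mean_backorders T U_min U_max lam K xh x (c, f')"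
proof -
  have c: "c < T" using assms(1) by (simp add: policies_def)
  then have T: "1 \<le> T" by simp
  let ?rs = "\<lambda>f. map (express_rate U_min U_max lam (c, f)) [0..<T]"
  let ?v = "\<lambda>f. poisson_mean K (?rs f) (\<lambda>y. ennreal (real y))"
  have nonneg: "0 \<le> r" if "r \<in> set (?rs f) \<or> r \<in> set (?rs f')" for r
    using that express_rate_bounds(1)[OF assms(1,3)] express_rate_bounds(1)[OF assms(2,3)] assms(4)
    by auto
  have prefix': "(\<Sum>j<min n (Suc c). f j) \<le> (\<Sum>j<min n (Suc c). f' j)" for n
  proof (cases "n \<le> c")
    case True
    then show ?thesis using prefix[of n] by simp
  next
    case False
    then have "min n (Suc c) = Suc c" by simp
    then show ?thesis using total by (simp add: lessThan_Suc_atMost del: sum.lessThan_Suc)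
  qed
  have "?v f y \<le> ?v f' y" for y
  proof (rule poisson_mean_le_if_earlier)
    show "mono (\<lambda>y. ennreal (real y))" by (auto intro!: monoI ennreal_leI)
    show "sum_list (take n (?rs f')) \<le> sum_list (take n (?rs f))" for n
      using assms(3,4) prefix'[of n]
      by (simp only: sum_list_take_express_rate[OF c assms(3)]) (intro mult_left_mono divide_nonneg_pos, auto)
    show "sum_list (?rs f) = sum_list (?rs f')"
      using sum_list_take_express_rate[OF c assms(3), of T lam f]
        sum_list_take_express_rate[OF c assms(3), of T lam f'] c total
      by (simp add: min_absorb2 lessThan_Suc_atMost)
  qed (use nonneg in auto)
  then have "enn2real ((period_mean K (poisson0_pmf lam) ^^ n) (?v f) x)
      \<le> enn2real ((period_mean K (poisson0_pmf lam) ^^ n) (?v f') x)" for n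
    using mean_backorders_limit(2)[OF assms(2,3,4) T assms(5)]
    by (intro enn2real_mono iterated_period_mean_le) auto
  then show ?thesis
    using mean_backorders_limit(1)[OF assms(1,3,4) T assms(5), of x xh]
      mean_backorders_limit(1)[OF assms(2,3,4) T assms(5), of x xh]
    by (intro LIMSEQ_le) auto
qed

theorem lemma6:
  fixes T c xh x\<Sigma> :: nat
    and lam U_min U_max fbar :: real
    and K :: "nat pmf"
    and f f' :: "nat \<Rightarrow> real"
  assumes "1 \<le> T" and "0 < lam" and "0 \<le> U_min" and "U_min < U_max"
    and "set_pmf K = UNIV" and "traffic_intensity lam K < 1"
    and "xh \<le> x\<Sigma>"
    and "(c, \<lambda>_. fbar) \<in> const_policies T U_min U_max"
    and "(c, f) \<in> policies T U_min U_max"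
    and "(c, f') \<in> policies T U_min U_max"
    and "fbar = 1 / real (c + 1) * (\<Sum>j=0..c. f j)"
    and "fbar = 1 / real (c + 1) * (\<Sum>j=0..c. f' j)"
    and "\<And>\<tau>. \<tau> \<in> {1..c} \<Longrightarrow>
           1 / real \<tau> * (\<Sum>j=0..\<tau> - 1. f j) \<le> 1 / real \<tau> * (\<Sum>j=0..\<tau> - 1. f' j)"
    and "\<And>\<tau>. \<tau> \<in> {1..c} \<Longrightarrow> 1 / real \<tau> * (\<Sum>j=0..\<tau> - 1. f' j) \<le> fbar"
  shows "mean_backorders T U_min U_max lam K xh x\<Sigma> (c, f)
           \<le> mean_backorders T U_min U_max lam K xh x\<Sigma> (c, f') \<and>
         mean_backorders T U_min U_max lam K xh x\<Sigma> (c, f')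
           \<le> mean_backorders T U_min U_max lam K xh x\<Sigma> (c, \<lambda>_. fbar)"
proof -
  have const: "(c, \<lambda>_. fbar) \<in> policies T U_min U_max"
    using assms(8) by (auto simp: const_policies_def policies_def fun_eq_iff)
  have total: "(\<Sum>j\<le>c. f j) = real (c + 1) * fbar" "(\<Sum>j\<le>c. f' j) = real (c + 1) * fbar"
    using assms(11,12) by (auto simp: atMost_atLeast0 field_simps)
  have range: "{0..n - Suc 0} = {..<n}" if "0 < n" for n :: nat
    using that by auto
  have prefix: "(\<Sum>j<n. f j) \<le> (\<Sum>j<n. f' j)" "(\<Sum>j<n. f' j) \<le> (\<Sum>j<n. fbar)" if "n \<le> c" for n
  proof -
    have "(\<Sum>j<n. f j) \<le> (\<Sum>j<n. f' j) \<and> (\<Sum>j<n. f' j) \<le> real n * fbar"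
    proof (cases "n = 0")
      case False
      then show ?thesis
        using assms(13)[of n] assms(14)[of n] that by (simp add: range field_simps)
    qed simp
    then show "(\<Sum>j<n. f j) \<le> (\<Sum>j<n. f' j)" "(\<Sum>j<n. f' j) \<le> (\<Sum>j<n. fbar)" by auto
  qed
  show ?thesis
    by (intro conjI mean_backorders_le_if_cheaper_earlier assms const prefix)
       (simp_all add: total)
qed

end
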